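(* Let $\theta\in\mathbb{R}^n$, $\tau\in(0,1]$, and suppose $F_\tau\neq\emptyset$. Then the PCD direction $\tilde d^*$ satisfies $$\tilde g_j^\top\tilde d^*\ \ge\ \tau\|\tilde g_j\|^2\quad\text{for all } j\in\{2,\dots,K\}.$$ Consequently, for $\theta^+=\theta-\eta\,\tilde d^*$ with step size $\eta>0$, and for each $j\in\{2,\dots,K\}$ such that $\mathcal{L}_j$ is differentiable with Lipschitz continuous gradient (or admits a Lipschitz continuous subgradient selection, i.e. a Lipschitz map $G_j:\mathbb{R}^n\to\mathbb{R}^n$ with $G_j(\vartheta)\in\partial\mathcal{L}_j(\vartheta)$ for all $\vartheta$ and $G_j(\theta)=g_j$), $$\mathcal{L}_j(\theta^+)\ \le\ \mathcal{L}_j(\theta)-\eta\,s_j^{-1}\tau\|\tilde g_j\|^2+O(\eta^2)\qquad(\eta\to0^+),$$ so that if $\tilde g_j\neq 0$ then $\mathcal{L}_j(\theta^+)<\mathcal{L}_j(\theta)$ for all sufficiently small $\eta>0$.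
   Context: There are $K\ge2$ objectives on $\mathbb{R}^n$: a primary objective $\mathcal{L}_1:\mathbb{R}^n\to\mathbb{R}$, continuously differentiable, with gradient $g_1=\nabla\mathcal{L}_1(\theta)$, and secondary objectives $\mathcal{L}_j:\mathbb{R}^n\to\mathbb{R}\cup\{+\infty\}$, $j=2,\dots,K$, each proper, convex and lower semicontinuous, with a chosen subgradient $g_j\in\partial\mathcal{L}_j(\theta)$ (equal to the gradient if $\mathcal{L}_j$ is differentiable). Normalized gradients are $\tilde g_i=s_ig_i$ with scalars $s_i>0$. The feasible set is $F_\tau=\bigcap_{j=2}^K\{d\in\mathbb{R}^n:\tilde g_j^\top d\ge\tau\|\tilde g_j\|^2\}$, with $\|\cdot\|$ the Euclidean norm, and the PCD direction is $\tilde d^*=\arg\min_{d\in F_\tau}\|d-\tilde g_1\|^2$. *)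

theory Defs
  imports "HOL-Analysis.Analysis"
begin

text \<open>Extended-real-valued objectives \<open>f : R^n \<rightarrow> R \<union> {+\<infinity>}\<close> are functions into \<^typ>\<open>ereal\<close>;
  the value \<open>-\<infinity>\<close> is excluded by properness.\<close>

definition proper_fun :: "('a \<Rightarrow> ereal) \<Rightarrow> bool" where
  "proper_fun f \<longleftrightarrow> (\<forall>x. f x \<noteq> -\<infinity>) \<and> (\<exists>x. f x \<noteq> \<infinity>)"

text \<open>At the endpoints \<open>t = 0, 1\<close> the convention \<open>0 * \<infinity> = 0\<close> of \<^typ>\<open>ereal\<close> makes the
  inequality trivial.\<close>

definition convex_fun :: "('a::real_vector \<Rightarrow> ereal) \<Rightarrow> bool" where
  "convex_fun f \<longleftrightarrow>
     (\<forall>x y. \<forall>t\<in>{0..1::real}.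
        f ((1 - t) *\<^sub>R x + t *\<^sub>R y) \<le> ereal (1 - t) * f x + ereal t * f y)"

definition lsc_fun :: "('a::topological_space \<Rightarrow> ereal) \<Rightarrow> bool" where
  "lsc_fun f \<longleftrightarrow> (\<forall>x. f x \<le> Liminf (at x) f)"

text \<open>For proper \<open>f\<close> this is empty at points where \<open>f\<close> is \<open>+\<infinity>\<close>.\<close>

definition subdifferential :: "('a::real_inner \<Rightarrow> ereal) \<Rightarrow> 'a \<Rightarrow> 'a set" where
  "subdifferential f x = {g. \<forall>y. f x + ereal (g \<bullet> (y - x)) \<le> f y}"

text \<open>Differentiability of an extended-real-valued function at \<open>x\<close> includes its finiteness
  near \<open>x\<close>; this clause is needed because \<^const>\<open>real_of_ereal\<close> maps infinite values to 0.\<close>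

definition has_gradient :: "('a::real_inner \<Rightarrow> ereal) \<Rightarrow> 'a \<Rightarrow> 'a \<Rightarrow> bool" where
  "has_gradient f D x \<longleftrightarrow>
     (\<forall>\<^sub>F y in nhds x. \<bar>f y\<bar> \<noteq> \<infinity>) \<and> GDERIV (\<lambda>y. real_of_ereal (f y)) x :> D"

definition lipschitz_gradient :: "('a::real_inner \<Rightarrow> ereal) \<Rightarrow> bool" where
  "lipschitz_gradient f \<longleftrightarrow>
     (\<exists>G C. (\<forall>x. has_gradient f (G x) x) \<and> C-lipschitz_on UNIV G)"

definition lipschitz_subgradient_selection ::
  "('a::real_inner \<Rightarrow> ereal) \<Rightarrow> 'a \<Rightarrow> 'a \<Rightarrow> bool" where
  "lipschitz_subgradient_selection f \<theta> g \<longleftrightarrow>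
     (\<exists>G C. C-lipschitz_on UNIV G \<and> (\<forall>x. G x \<in> subdifferential f x) \<and> G \<theta> = g)"

definition normalized :: "(nat \<Rightarrow> real) \<Rightarrow> (nat \<Rightarrow> 'a::real_vector) \<Rightarrow> nat \<Rightarrow> 'a" where
  "normalized s g i = s i *\<^sub>R g i"

definition feasible_set :: "nat \<Rightarrow> (nat \<Rightarrow> 'a::real_inner) \<Rightarrow> real \<Rightarrow> 'a set" where
  "feasible_set K gt \<tau> = (\<Inter>j\<in>{2..K}. {d. gt j \<bullet> d \<ge> \<tau> * (norm (gt j))\<^sup>2})"

definition pcd_direction :: "nat \<Rightarrow> (nat \<Rightarrow> 'a::real_inner) \<Rightarrow> real \<Rightarrow> 'a" where
  "pcd_direction K gt \<tau> = arg_min_on (\<lambda>d. (norm (d - gt 1))\<^sup>2) (feasible_set K gt \<tau>)"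

end

theory Submission
  imports Defs
begin

text \<open>The direction is a nearest point of a nonempty closed set, so it is feasible. For the descent
  estimate, use the subgradient inequality at the new point \<open>\<theta>\<^sup>+\<close>, not at \<open>\<theta>\<close>: it gives
  \<open>\<L>\<^sub>j(\<theta>\<^sup>+) \<le> \<L>\<^sub>j(\<theta>) - \<eta> G\<^sub>j(\<theta>\<^sup>+) \<bullet> d\<close>, and replacing \<open>G\<^sub>j(\<theta>\<^sup>+)\<close> by \<open>G\<^sub>j(\<theta>) = g\<^sub>j\<close> costs
  at most \<open>C \<eta>\<^sup>2 \<parallel>d\<parallel>\<^sup>2\<close>, where \<open>C\<close> is the Lipschitz constant. By convexity
  a Lipschitz gradient is a Lipschitz subgradient selection.\<close>

lemma closed_feasible_set: "closed (feasible_set K gt \<tau>)"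
  unfolding feasible_set_def
  by (intro closed_INT ballI closed_Collect_le continuous_intros)

text \<open>\<open>arg_min_on\<close> is a choice operator, so nothing is known of its value until
  some minimiser is exhibited. Closedness and finite dimension supply a nearest point to
  \<open>gt 1\<close>, and squaring distances keeps it minimal.\<close>

lemma pcd_direction_feasible:
  fixes gt :: "nat \<Rightarrow> 'a::euclidean_space"
  assumes "feasible_set K gt \<tau> \<noteq> {}"
  shows "pcd_direction K gt \<tau> \<in> feasible_set K gt \<tau>"
proof -
  obtain x where x: "x \<in> feasible_set K gt \<tau>"
    and min: "\<And>y. y \<in> feasible_set K gt \<tau> \<Longrightarrow> dist (gt 1) x \<le> dist (gt 1) y"
    using distance_attains_inf[OF closed_feasible_set assms] by blast
  have "is_arg_min (\<lambda>d. (norm (d - gt 1))\<^sup>2) (\<lambda>d. d \<in> feasible_set K gt \<tau>) x"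
    using x min by (auto simp: is_arg_min_linorder dist_norm norm_minus_commute intro!: power_mono)
  then have "is_arg_min (\<lambda>d. (norm (d - gt 1))\<^sup>2) (\<lambda>d. d \<in> feasible_set K gt \<tau>)
      (pcd_direction K gt \<tau>)"
    unfolding pcd_direction_def arg_min_on_def arg_min_def by (rule someI)
  then show ?thesis by (simp add: is_arg_min_def)
qed

text \<open>Testing the subgradient inequality at a point where \<open>f\<close> is finite rules out
  \<open>f x = \<infinity>\<close>. This allows the later estimates to be carried out in the
  reals.\<close>

lemma subdifferential_imp_finite:
  assumes "proper_fun f" "g \<in> subdifferential f x"
  obtains a where "f x = ereal a"
proof -
  obtain z where z: "f z \<noteq> \<infinity>" using assms(1) by (auto simp: proper_fun_def)
  have "f x + ereal (g \<bullet> (z - x)) \<le> f z" using assms(2) by (auto simp: subdifferential_def)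
  then have "f x \<noteq> \<infinity>" using z by auto
  moreover have "f x \<noteq> -\<infinity>" using assms(1) by (auto simp: proper_fun_def)
  ultimately show thesis using that by (cases "f x") auto
qed

text \<open>On the segment from \<open>x\<close> to \<open>y\<close>, convexity bounds the
  difference quotients at \<open>x\<close> by the chord slope \<open>f y - f x\<close>. Their limit
  from the right is the directional derivative \<open>D \<bullet> (y - x)\<close>.\<close>

lemma convex_has_gradient_imp_subdifferential:
  assumes "proper_fun f" "convex_fun f" and grad: "has_gradient f D x"
  shows "D \<in> subdifferential f x"
  unfolding subdifferential_def
proof (intro CollectI allI)
  fix y
  define F where "F = (\<lambda>z. real_of_ereal (f z))"
  have near: "\<forall>\<^sub>F z in nhds x. \<bar>f z\<bar> \<noteq> \<infinity>" and der: "GDERIV F x :> D"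
    using grad by (auto simp: has_gradient_def F_def)
  have fx: "f x = ereal (F x)"
    using eventually_nhds_x_imp_x[OF near] by (auto simp: F_def ereal_real)
  show "f x + ereal (D \<bullet> (y - x)) \<le> f y"
  proof (cases "f y")
    case (real b)
    have seg: "((\<lambda>t. x + t *\<^sub>R (y - x)) \<longlongrightarrow> x) (at_right (0::real))"
      by (auto intro!: tendsto_eq_intros)
    \<comment> \<open>Finiteness is what lets \<open>F\<close> stand for \<open>f\<close> on the
      segment, as \<open>real_of_ereal\<close> sends infinite values to 0.\<close>
    have finite: "\<forall>\<^sub>F t in at_right (0::real). \<bar>f (x + t *\<^sub>R (y - x))\<bar> \<noteq> \<infinity>"
      using filterlim_iff[THEN iffD1, OF seg] near by blast
    have "\<forall>\<^sub>F t in at_right (0::real). t < 1"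
      by (intro eventually_at_rightI[of 0 1]) auto
    with finite eventually_at_right_less[of "0::real"]
    have quotient_le: "\<forall>\<^sub>F t in at_right (0::real). (F (x + t *\<^sub>R (y - x)) - F x) / t \<le> b - F x"
    proof eventually_elim
      case (elim t)
      have "f ((1 - t) *\<^sub>R x + t *\<^sub>R y) \<le> ereal (1 - t) * f x + ereal t * f y"
        using assms(2) elim by (auto simp: convex_fun_def)
      moreover have "(1 - t) *\<^sub>R x + t *\<^sub>R y = x + t *\<^sub>R (y - x)"
        by (simp add: algebra_simps)
      moreover have "f (x + t *\<^sub>R (y - x)) = ereal (F (x + t *\<^sub>R (y - x)))"
        using elim by (auto simp: F_def ereal_real)
      ultimately have "F (x + t *\<^sub>R (y - x)) \<le> (1 - t) * F x + t * b"
        by (simp add: fx real)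
      then show ?case using elim by (simp add: field_simps)
    qed
    have affine: "((\<lambda>t. x + t *\<^sub>R (y - x)) has_derivative (\<lambda>t. t *\<^sub>R (y - x))) (at (0::real))"
      by (auto intro!: derivative_eq_intros)
    \<comment> \<open>The base point is written as the value of the affine map at 0, so that the
      chain rule applies literally.\<close>
    have "(F has_derivative (\<lambda>h. h \<bullet> D)) (at (x + 0 *\<^sub>R (y - x)))"
      using der by (simp add: gderiv_def)
    from has_derivative_compose[OF affine this]
    have "((\<lambda>t. F (x + t *\<^sub>R (y - x))) has_real_derivative D \<bullet> (y - x)) (at 0)"
      by (simp add: has_field_derivative_def inner_commute mult_commute_abs)
    then have "((\<lambda>t. F (x + t *\<^sub>R (y - x))) has_real_derivative D \<bullet> (y - x)) (at_right 0)"
      by (rule has_field_derivative_at_within)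
    then have "((\<lambda>t. (F (x + t *\<^sub>R (y - x)) - F x) / t) \<longlongrightarrow> D \<bullet> (y - x)) (at_right 0)"
      by (simp add: has_field_derivative_iff)
    from tendsto_upperbound[OF this quotient_le] have "D \<bullet> (y - x) \<le> b - F x" by simp
    then show ?thesis by (simp add: fx real)
  qed (use assms(1) in \<open>auto simp: proper_fun_def\<close>)
qed

text \<open>The gradient map itself is the selection; the last assumption makes it pass through the
  chosen \<open>g\<close> at \<open>\<theta>\<close>.\<close>

lemma lipschitz_gradient_imp_subgradient_selection:
  assumes "proper_fun f" "convex_fun f" "lipschitz_gradient f"
    and "\<And>D. has_gradient f D \<theta> \<Longrightarrow> g = D"
  shows "lipschitz_subgradient_selection f \<theta> g"
proof -
  obtain G C where G: "\<And>x. has_gradient f (G x) x" "C-lipschitz_on UNIV G"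
    using assms(3) by (auto simp: lipschitz_gradient_def)
  then show ?thesis
    using assms(4)[OF G(1)] convex_has_gradient_imp_subdifferential[OF assms(1,2)]
    unfolding lipschitz_subgradient_selection_def by blast
qed

lemma lipschitz_subgradient_descent:
  assumes "proper_fun f" "C-lipschitz_on UNIV G" and sub: "\<And>x. G x \<in> subdifferential f x"
    and "0 < \<eta>"
  shows "f (\<theta> - \<eta> *\<^sub>R d) \<le> f \<theta> - ereal (\<eta> * (G \<theta> \<bullet> d)) + ereal (C * (norm d)\<^sup>2 * \<eta>\<^sup>2)"
proof -
  let ?y = "\<theta> - \<eta> *\<^sub>R d"
  obtain a where a: "f \<theta> = ereal a" using subdifferential_imp_finite[OF assms(1) sub] .
  obtain b where b: "f ?y = ereal b" using subdifferential_imp_finite[OF assms(1) sub] .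
  have "f ?y + ereal (G ?y \<bullet> (\<theta> - ?y)) \<le> f \<theta>"
    using sub[of ?y] unfolding subdifferential_def by blast
  then have "b + \<eta> * (G ?y \<bullet> d) \<le> a" by (simp add: a b)
  moreover have "(G \<theta> - G ?y) \<bullet> d \<le> C * \<eta> * (norm d)\<^sup>2"
  proof -
    have "(G \<theta> - G ?y) \<bullet> d \<le> norm (G \<theta> - G ?y) * norm d" by (rule norm_cauchy_schwarz)
    also have "\<dots> \<le> (C * norm (\<theta> - ?y)) * norm d"
      using lipschitz_onD[OF assms(2), of \<theta> ?y] by (intro mult_right_mono) (auto simp: dist_norm)
    finally show ?thesis using \<open>0 < \<eta>\<close> by (simp add: power2_eq_square mult_ac)
  qed
  then have "\<eta> * ((G \<theta> - G ?y) \<bullet> d) \<le> \<eta> * (C * \<eta> * (norm d)\<^sup>2)"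
    using \<open>0 < \<eta>\<close> by (intro mult_left_mono) auto
  ultimately have "b \<le> a - \<eta> * (G \<theta> \<bullet> d) + C * (norm d)\<^sup>2 * \<eta>\<^sup>2"
    by (simp add: algebra_simps inner_diff_left power2_eq_square)
  then show ?thesis by (simp add: a b)
qed

theorem proposition4p4:
  fixes K :: nat
    and L1 :: "real ^ 'n \<Rightarrow> real"
    and L :: "nat \<Rightarrow> real ^ 'n \<Rightarrow> ereal"
    and g :: "nat \<Rightarrow> real ^ 'n"
    and s :: "nat \<Rightarrow> real"
    and \<theta> :: "real ^ 'n"
    and \<tau> :: real
  defines "gt \<equiv> normalized s g"
  defines "d \<equiv> pcd_direction K gt \<tau>"
  assumes "K \<ge> 2"
    and L1_C1: "\<exists>D. (\<forall>x. GDERIV L1 x :> D x) \<and> continuous_on UNIV D"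
    and g1: "GDERIV L1 \<theta> :> g 1"
    and proper: "\<And>j. j \<in> {2..K} \<Longrightarrow> proper_fun (L j)"
    and convex: "\<And>j. j \<in> {2..K} \<Longrightarrow> convex_fun (L j)"
    and lsc: "\<And>j. j \<in> {2..K} \<Longrightarrow> lsc_fun (L j)"
    and subgrad: "\<And>j. j \<in> {2..K} \<Longrightarrow> g j \<in> subdifferential (L j) \<theta>"
    and grad: "\<And>j D. j \<in> {2..K} \<Longrightarrow> has_gradient (L j) D \<theta> \<Longrightarrow> g j = D"
    and s_pos: "\<And>i. i \<in> {1..K} \<Longrightarrow> s i > 0"
    and tau: "0 < \<tau>" "\<tau> \<le> 1"
    and feasible: "feasible_set K gt \<tau> \<noteq> {}"
  shows "(\<forall>j\<in>{2..K}. gt j \<bullet> d \<ge> \<tau> * (norm (gt j))\<^sup>2) \<and>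
    (\<forall>j\<in>{2..K}.
       lipschitz_gradient (L j) \<or> lipschitz_subgradient_selection (L j) \<theta> (g j) \<longrightarrow>
         (\<exists>r. r \<in> O[at_right 0](\<lambda>\<eta>::real. \<eta>\<^sup>2) \<and>
            (\<forall>\<eta>>0. L j (\<theta> - \<eta> *\<^sub>R d)
               \<le> L j \<theta> - ereal (\<eta> * inverse (s j) * \<tau> * (norm (gt j))\<^sup>2) + ereal (r \<eta>))) \<and>
         (gt j \<noteq> 0 \<longrightarrow> (\<forall>\<^sub>F \<eta> in at_right 0. L j (\<theta> - \<eta> *\<^sub>R d) < L j \<theta>)))"
proof (intro conjI ballI impI)
  have feas: "\<tau> * (norm (gt j))\<^sup>2 \<le> gt j \<bullet> d" if "j \<in> {2..K}" for j
    using pcd_direction_feasible[OF feasible] that by (auto simp: feasible_set_def d_def)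
  then show "\<tau> * (norm (gt j))\<^sup>2 \<le> gt j \<bullet> d" if "j \<in> {2..K}" for j
    using that .
  fix j
  assume j: "j \<in> {2..K}"
    and "lipschitz_gradient (L j) \<or> lipschitz_subgradient_selection (L j) \<theta> (g j)"
  then have "lipschitz_subgradient_selection (L j) \<theta> (g j)"
    using lipschitz_gradient_imp_subgradient_selection[OF proper convex _ grad] by blast
  then obtain G C where C: "C-lipschitz_on UNIV G"
    and G: "\<And>x. G x \<in> subdifferential (L j) x" "G \<theta> = g j"
    by (auto simp: lipschitz_subgradient_selection_def)
  \<comment> \<open>The guaranteed first-order rate of decrease: dividing the feasibility constraint
    by \<open>s j\<close> turns \<open>gt j\<close> into \<open>g j\<close> and gives
    \<open>c \<le> g j \<bullet> d\<close>.\<close>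
  define c where "c = inverse (s j) * \<tau> * (norm (gt j))\<^sup>2"
  \<comment> \<open>The coefficient of the quadratic error; it is independent of
    \<open>\<eta>\<close>, so \<open>M * \<eta>\<^sup>2\<close> serves as the remainder
    \<open>r\<close>.\<close>
  define M where "M = C * (norm d)\<^sup>2"
  obtain a where a: "L j \<theta> = ereal a"
    using subdifferential_imp_finite[OF proper subgrad] j by blast
  have s: "s j > 0" using s_pos j by auto
  have c_le: "c \<le> g j \<bullet> d"
    using feas[OF j] s by (simp add: c_def gt_def normalized_def field_simps)
  have descent: "L j (\<theta> - \<eta> *\<^sub>R d) \<le> L j \<theta> - ereal (\<eta> * c) + ereal (M * \<eta>\<^sup>2)" if "\<eta> > 0" for \<eta>
  proof -
    have "L j (\<theta> - \<eta> *\<^sub>R d) \<le> ereal (a - \<eta> * (g j \<bullet> d) + M * \<eta>\<^sup>2)"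
      using lipschitz_subgradient_descent[OF proper[OF j] C G(1) that, of \<theta> d] by (simp add: a G(2) M_def)
    also have "\<dots> \<le> ereal (a - \<eta> * c + M * \<eta>\<^sup>2)"
      using mult_left_mono[OF c_le, of \<eta>] that by simp
    finally show ?thesis by (simp add: a)
  qed
  show "\<exists>r. r \<in> O[at_right 0](\<lambda>\<eta>::real. \<eta>\<^sup>2) \<and>
      (\<forall>\<eta>>0. L j (\<theta> - \<eta> *\<^sub>R d)
        \<le> L j \<theta> - ereal (\<eta> * inverse (s j) * \<tau> * (norm (gt j))\<^sup>2) + ereal (r \<eta>))"
    using descent by (intro exI[of _ "\<lambda>\<eta>. M * \<eta>\<^sup>2"]) (auto simp: c_def mult.assoc)
  assume "gt j \<noteq> 0"
  then have "0 < c" using s tau by (simp add: c_def)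
  \<comment> \<open>The guaranteed decrease factors as \<open>\<eta> * (c - M * \<eta>)\<close>, so
    its sign for small \<open>\<eta>\<close> is that of \<open>c\<close>. Strictness also relies on
    \<open>L j \<theta>\<close> being the real number \<open>a\<close>.\<close>
  have "((\<lambda>\<eta>. c - M * \<eta>) \<longlongrightarrow> c) (at_right 0)"
    by (auto intro!: tendsto_eq_intros)
  then have "\<forall>\<^sub>F \<eta> in at_right 0. 0 < c - M * \<eta>"
    using \<open>0 < c\<close> by (rule order_tendstoD)
  with eventually_at_right_less[of "0::real"]
  show "\<forall>\<^sub>F \<eta> in at_right 0. L j (\<theta> - \<eta> *\<^sub>R d) < L j \<theta>"
  proof eventually_elim
    case (elim \<eta>)
    have "0 < \<eta> * (c - M * \<eta>)" using elim by simp
    then have "L j \<theta> - ereal (\<eta> * c) + ereal (M * \<eta>\<^sup>2) < L j \<theta>"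
      by (simp add: a algebra_simps power2_eq_square)
    then show ?case using descent[OF elim(1)] by (rule order.strict_trans1[rotated])
  qed
qed

end
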